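(* Let $G$ be the whirl graph (defined in the context). Then $G$ is a countable planar graph such that for every two distinct vertices $u,v$ of $G$ and every $k\in\mathbb{N}$, $G$ contains $k$ edge-disjoint pairwise order-compatible $u$–$v$ paths; but for no two distinct vertices $u,v$ of $G$ does $G$ contain infinitely many edge-disjoint pairwise order-compatible $u$–$v$ paths.
   Context: The whirl graph is the graph $G=(V,E)$ with vertex set $V:=\bigcup_{n\ge 1}V_n\subseteq\mathbb{Q}$, where $V_n:=\{\tfrac{0}{3^n},\tfrac{1}{3^n},\dots,\tfrac{3^n}{3^n}\}$ (vertices are rational numbers, so e.g. $\tfrac{3}{9}=\tfrac13$), and edge set $E:=\bigcup_{n\ge1}E_n$, where $E_n:=\big\{\{\tfrac{3k}{3^n},\tfrac{3k+2}{3^n}\},\{\tfrac{3k+1}{3^n},\tfrac{3k+2}{3^n}\},\{\tfrac{3k+1}{3^n},\tfrac{3k+3}{3^n}\} : k\in\{0,1,\dots,3^{n-1}-1\}\big\}$. Two $u$–$v$ paths are order-compatible if they traverse their common vertices in the same order. *)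

theory Defs
  imports "HOL-Analysis.Analysis"
begin

definition simple_graph :: "'a set \<Rightarrow> 'a set set \<Rightarrow> bool" where
  "simple_graph V E \<longleftrightarrow> (\<forall>e\<in>E. e \<subseteq> V \<and> card e = 2)"

text \<open>Planarity of a possibly infinite graph: it has a drawing in the plane in which vertices
  are distinct points, every edge is an arc between its endvertices, and the interior of an
  edge contains no vertex and no point of any other edge. (For vertices of infinite degree, the
  subspace topology of the drawing need not be that of the 1-complex.)\<close>

definition planar_graph :: "'a set \<Rightarrow> 'a set set \<Rightarrow> bool" where
  "planar_graph V E \<longleftrightarrow>
    (\<exists>(pt :: 'a \<Rightarrow> real \<times> real) (crv :: 'a set \<Rightarrow> real \<Rightarrow> real \<times> real).
      inj_on pt V \<and>
      (\<forall>e\<in>E. arc (crv e) \<and> {pathstart (crv e), pathfinish (crv e)} = pt ` e \<and>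
        (path_image (crv e) - pt ` e) \<inter> pt ` V = {}) \<and>
      (\<forall>e\<in>E. \<forall>e'\<in>E. e \<noteq> e' \<longrightarrow>
        (path_image (crv e) - pt ` e) \<inter> path_image (crv e') = {}))"

definition path_edges :: "'a list \<Rightarrow> 'a set set" where
  "path_edges p = {{p ! i, p ! Suc i} | i. Suc i < length p}"

definition is_uv_path :: "'a set \<Rightarrow> 'a set set \<Rightarrow> 'a \<Rightarrow> 'a \<Rightarrow> 'a list \<Rightarrow> bool" where
  "is_uv_path V E u v p \<longleftrightarrow>
    p \<noteq> [] \<and> hd p = u \<and> last p = v \<and> distinct p \<and> set p \<subseteq> V \<and> path_edges p \<subseteq> E"

definition precedes_in :: "'a list \<Rightarrow> 'a \<Rightarrow> 'a \<Rightarrow> bool" where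
  "precedes_in p x y \<longleftrightarrow> (\<exists>i j. i < j \<and> j < length p \<and> p ! i = x \<and> p ! j = y)"

definition order_compatible :: "'a list \<Rightarrow> 'a list \<Rightarrow> bool" where
  "order_compatible p q \<longleftrightarrow>
    (\<forall>x \<in> set p \<inter> set q. \<forall>y \<in> set p \<inter> set q. precedes_in p x y \<longleftrightarrow> precedes_in q x y)"

definition edge_disjoint :: "'a list \<Rightarrow> 'a list \<Rightarrow> bool" where
  "edge_disjoint p q \<longleftrightarrow> path_edges p \<inter> path_edges q = {}"

definition whirl_Vn :: "nat \<Rightarrow> rat set" where
  "whirl_Vn n = {of_nat i / 3 ^ n | i. i \<le> 3 ^ n}"

definition whirl_En :: "nat \<Rightarrow> rat set set" where
  "whirl_En n = (\<Union>k \<in> {0..<3 ^ (n - 1)}.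
     {{of_nat (3 * k) / 3 ^ n, of_nat (3 * k + 2) / 3 ^ n},
      {of_nat (3 * k + 1) / 3 ^ n, of_nat (3 * k + 2) / 3 ^ n},
      {of_nat (3 * k + 1) / 3 ^ n, of_nat (3 * k + 3) / 3 ^ n}})"

definition whirl_V :: "rat set" where
  "whirl_V = (\<Union>n \<in> {1..}. whirl_Vn n)"

definition whirl_E :: "rat set set" where
  "whirl_E = (\<Union>n \<in> {1..}. whirl_En n)"

end

theory Submission imports Defs begin

text \<open>The edges of level \<open>n\<close> join the ends and the two inner triadic points of each interval
  \<open>[a, a + 3 d]\<close>, \<open>d = 3\<^sup>-\<^sup>n\<close>, by the zigzag \<open>a, a + 2 d, a + d, a + 3 d\<close>, and no edge of a later
  level passes over a point of \<open>V\<^sub>n\<close>.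

  Planarity: with the vertices placed on the real line, two edges can cross only if they are the
  first and the last edge of the same zigzag, so drawing the last edges below the line and all
  others above it gives a planar drawing.

  Finite families: the three thirds of an interval together with the two long edges of its zigzag
  carry one path more than each of the thirds, and this can be iterated.

  Infinite families: let \<open>p\<close> be a path of the family that uses only edges of levels above those of
  \<open>u < v\<close>, and let \<open>N\<close> be the largest level in \<open>p\<close>. Some other path of the family avoids all edges of
  level at most \<open>N\<close>, hence visits the points of \<open>V\<^sub>N\<close> between \<open>u\<close> and \<open>v\<close> in increasing
  order, so \<open>p\<close> is increasing. But \<open>p\<close> has an inner vertex that is new at level \<open>N\<close>, and the only
  two edges of level at most \<open>N\<close> at such a vertex leave it to the same side.\<close>

section \<open>Triadic points\<close>

definition triadic :: "nat \<Rightarrow> nat \<Rightarrow> rat" where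
  "triadic n i = of_nat i / 3 ^ n"

lemma triadic_less_iff [simp]: "triadic n i < triadic n j \<longleftrightarrow> i < j"
  by (simp add: triadic_def divide_less_cancel)

lemma triadic_eq_iff [simp]: "triadic n i = triadic n j \<longleftrightarrow> i = j"
  by (simp add: triadic_def)

lemma triadic_refine: "triadic n i = triadic (n + m) (i * 3 ^ m)"
  by (simp add: triadic_def power_add)

lemma triadic_Suc: "triadic n i = triadic (Suc n) (3 * i)"
  using triadic_refine[of n i 1] by (simp add: mult.commute)

lemma whirl_Vn_iff: "x \<in> whirl_Vn n \<longleftrightarrow> (\<exists>i\<le>3 ^ n. x = triadic n i)"
  by (auto simp: whirl_Vn_def triadic_def)

lemma triadic_in_whirl_Vn: "triadic n i \<in> whirl_Vn n \<longleftrightarrow> i \<le> 3 ^ n"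
  by (auto simp: whirl_Vn_iff)

lemma whirl_Vn_mono: assumes "n \<le> m" shows "whirl_Vn n \<subseteq> whirl_Vn m"
proof
  fix x assume "x \<in> whirl_Vn n"
  then obtain i where i: "i \<le> 3 ^ n" "x = triadic n i" by (auto simp: whirl_Vn_iff)
  obtain d where d: "m = n + d" using assms le_Suc_ex by blast
  have "x = triadic m (i * 3 ^ d)" using i d triadic_refine by simp
  moreover have "i * 3 ^ d \<le> 3 ^ m" using i d by (simp add: power_add)
  ultimately show "x \<in> whirl_Vn m" by (auto simp: whirl_Vn_iff)
qed

lemma whirl_Vn_subset_V: "whirl_Vn n \<subseteq> whirl_V"
  \<comment> \<open>\<open>whirl_V\<close> collects the levels from 1 on, so passing to
    \<open>Suc n\<close> also covers level 0.\<close>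
  using whirl_Vn_mono[of n "Suc n"] by (force simp: whirl_V_def)

lemma whirl_V_common_level:
  assumes "u \<in> whirl_V" "v \<in> whirl_V"
  obtains n where "u \<in> whirl_Vn n" "v \<in> whirl_Vn n"
proof -
  obtain n1 n2 where "u \<in> whirl_Vn n1" "v \<in> whirl_Vn n2"
    using assms by (auto simp: whirl_V_def)
  then have "u \<in> whirl_Vn (max n1 n2)" "v \<in> whirl_Vn (max n1 n2)"
    using whirl_Vn_mono[of n1 "max n1 n2"] whirl_Vn_mono[of n2 "max n1 n2"] by auto
  then show thesis using that by blast
qed

text \<open>Writing the level as \<open>Suc m\<close> turns the truncated \<open>n - 1\<close> of
  the definition into \<open>m\<close>. The offset pairs are the three edges of one zigzag, smaller
  endpoint first.\<close>

lemma whirl_En_iff: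
  "e \<in> whirl_En (Suc m) \<longleftrightarrow> (\<exists>k<3 ^ m. \<exists>(i, j) \<in> {(0, 2), (1, 2), (1, 3)}.
     e = {triadic (Suc m) (3 * k + i), triadic (Suc m) (3 * k + j)})"
  by (auto simp: whirl_En_def triadic_def)

lemma whirl_En_cases:
  assumes "e \<in> whirl_En (Suc m)"
  obtains k i j where "k < 3 ^ m" "(i, j) \<in> {(0, 2), (1, 2), (1, 3)}"
    "e = {triadic (Suc m) (3 * k + i), triadic (Suc m) (3 * k + j)}"
  using assms by (fastforce simp: whirl_En_iff)

lemma whirl_E_cases:
  assumes "e \<in> whirl_E"
  obtains m where "e \<in> whirl_En (Suc m)"
proof -
  obtain n where n: "n \<ge> 1" "e \<in> whirl_En n" using assms by (auto simp: whirl_E_def)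
  then show thesis using that[of "n - 1"] by simp
qed

lemma whirl_EnI: "e \<in> whirl_En (Suc m) \<Longrightarrow> e \<in> whirl_E"
  by (auto simp: whirl_E_def)

lemma whirl_En_subset:
  assumes "e \<in> whirl_En (Suc m)" shows "e \<subseteq> whirl_Vn (Suc m)"
proof -
  obtain k i j where k: "k < 3 ^ m" "(i, j) \<in> {(0, 2), (1, 2), (1, 3::nat)}"
    "e = {triadic (Suc m) (3 * k + i), triadic (Suc m) (3 * k + j)}"
    using assms whirl_En_cases by metis
  have "3 * k + i \<le> 3 ^ Suc m" "3 * k + j \<le> 3 ^ Suc m" using k(1,2) by auto
  then show ?thesis using k(3) triadic_in_whirl_Vn by blast
qed

lemma whirl_E_ordered:
  assumes "e \<in> whirl_E"
  obtains a b where "a < b" "e = {a, b}"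
proof -
  obtain m where "e \<in> whirl_En (Suc m)" using assms whirl_E_cases by blast
  then obtain k i j where k: "(i, j) \<in> {(0, 2), (1, 2), (1, 3::nat)}"
    "e = {triadic (Suc m) (3 * k + i), triadic (Suc m) (3 * k + j)}"
    using whirl_En_cases by metis
  then have "triadic (Suc m) (3 * k + i) < triadic (Suc m) (3 * k + j)" by auto
  then show thesis using that k by blast
qed

lemma finite_whirl_En: "finite (whirl_En n)"
  by (auto simp: whirl_En_def)

text \<open>At level \<open>Suc m\<close> the points of \<open>whirl_Vn m\<close> have numerators
  divisible by 3, while the edge stays inside one block from \<open>3 * k\<close> to
  \<open>3 * k + 3\<close>.\<close>

lemma whirl_En_no_straddle:
  assumes e: "{x, y} \<in> whirl_En (Suc m)" and c: "c \<in> whirl_Vn m"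
  shows "\<not> (x < c \<and> c < y)"
proof
  assume *: "x < c \<and> c < y"
  obtain t where t: "c = triadic (Suc m) (3 * t)"
    using c triadic_Suc by (auto simp: whirl_Vn_iff)
  obtain k i j where k: "(i, j) \<in> {(0, 2), (1, 2), (1, 3::nat)}"
    "{x, y} = {triadic (Suc m) (3 * k + i), triadic (Suc m) (3 * k + j)}"
    using e whirl_En_cases by metis
  have "i \<le> 3" "j \<le> 3" using k(1) by auto
  moreover have "(x = triadic (Suc m) (3 * k + i) \<and> y = triadic (Suc m) (3 * k + j)) \<or>
    (y = triadic (Suc m) (3 * k + i) \<and> x = triadic (Suc m) (3 * k + j))"
    using k(2) by (metis doubleton_eq_iff)
  ultimately show False using * t by auto presburger+
qed

lemma whirl_simple_graph: "simple_graph whirl_V whirl_E"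
  unfolding simple_graph_def
proof
  fix e assume "e \<in> whirl_E"
  then obtain m where "e \<in> whirl_En (Suc m)" by (rule whirl_E_cases)
  then have "e \<subseteq> whirl_V" using whirl_En_subset whirl_Vn_subset_V by blast
  moreover have "card e = 2" using \<open>e \<in> whirl_E\<close> by (metis whirl_E_ordered card_2_iff less_irrefl)
  ultimately show "e \<subseteq> whirl_V \<and> card e = 2" by blast
qed

section \<open>Planarity\<close>

text \<open>These are the last edges of the zigzags. An edge is a bare pair of rationals without a
  recorded level, hence the existential form, and \<open>not_lower_page\<close> has to exclude
  coincidences between levels.\<close>

definition lower_page :: "rat set \<Rightarrow> bool" where
  "lower_page e \<longleftrightarrow> (\<exists>m k. e = {triadic (Suc m) (3 * k + 1), triadic (Suc m) (3 * k + 3)})"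

text \<open>The length \<open>2 / 3 ^ Suc m\<close> determines the level; after that the numerators
  of the left endpoints would be congruent to both 0 and 1 modulo 3.\<close>

lemma not_lower_page:
  assumes "e = {triadic (Suc m) (3 * k), triadic (Suc m) (3 * k + 2)}"
  shows "\<not> lower_page e"
proof
  assume "lower_page e"
  then obtain m' k' where "e = {triadic (Suc m') (3 * k' + 1), triadic (Suc m') (3 * k' + 3)}"
    by (auto simp: lower_page_def)
  then have eq: "triadic (Suc m) (3 * k) = triadic (Suc m') (3 * k' + 1)"
    "triadic (Suc m) (3 * k + 2) = triadic (Suc m') (3 * k' + 3)"
    using assms triadic_less_iff[of "Suc m" "3 * k" "3 * k + 2"]
      triadic_less_iff[of "Suc m'" "3 * k' + 1" "3 * k' + 3"]
    by (auto simp: doubleton_eq_iff simp del: triadic_less_iff)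
  moreover have "triadic (Suc m) (3 * k + 2) - triadic (Suc m) (3 * k) = 2 / 3 ^ Suc m"
    "triadic (Suc m') (3 * k' + 3) - triadic (Suc m') (3 * k' + 1) = 2 / 3 ^ Suc m'"
    unfolding triadic_def diff_divide_distrib[symmetric] by simp_all
  ultimately have "2 / 3 ^ Suc m = (2 / 3 ^ Suc m' :: rat)" by metis
  then have "(3::rat) ^ Suc m = 3 ^ Suc m'" by (simp add: field_simps)
  then have "Suc m = Suc m'" by (metis power_inject_exp one_less_numeral_iff semiring_norm(77))
  then have "3 * k = 3 * k' + 1" using eq(1) triadic_eq_iff by metis
  then show False by presburger
qed

text \<open>If the levels differ, an endpoint of the coarser edge lies strictly inside the finer
  one, contradicting \<open>whirl_En_no_straddle\<close>. If they agree, both edges belong to the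
  same zigzag, where only the first and the last edge interleave.\<close>

lemma crossing_edges_on_different_pages:
  assumes e: "{a, b} \<in> whirl_E" and e': "{c, d} \<in> whirl_E"
    and cross: "a < c" "c < b" "b < d"
  shows "lower_page {a, b} \<noteq> lower_page {c, d}"
proof -
  obtain m m' where m: "{a, b} \<in> whirl_En (Suc m)" and m': "{c, d} \<in> whirl_En (Suc m')"
    using e e' whirl_E_cases by metis
  consider "Suc m \<le> m'" | "Suc m' \<le> m" | "m = m'" by linarith
  then show ?thesis
  proof cases
    case 1
    then have "b \<in> whirl_Vn m'" using whirl_En_subset[OF m] whirl_Vn_mono by blast
    then show ?thesis using whirl_En_no_straddle[OF m'] cross by blast
  next
    case 2
    then have "c \<in> whirl_Vn m" using whirl_En_subset[OF m'] whirl_Vn_mono by blast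
    then show ?thesis using whirl_En_no_straddle[OF m] cross by blast
  next
    case 3
    obtain k i j where k: "(i, j) \<in> {(0, 2), (1, 2), (1, 3::nat)}"
      "{a, b} = {triadic (Suc m) (3 * k + i), triadic (Suc m) (3 * k + j)}"
      using m whirl_En_cases by metis
    obtain k' i' j' where k': "(i', j') \<in> {(0, 2), (1, 2), (1, 3::nat)}"
      "{c, d} = {triadic (Suc m) (3 * k' + i'), triadic (Suc m) (3 * k' + j')}"
      using m' 3 whirl_En_cases by metis
    have ij: "i < j" "j \<le> 3" "i' < j'" "j' \<le> 3" using k(1) k'(1) by auto
    have "triadic (Suc m) (3 * k + i) < triadic (Suc m) (3 * k + j)"
      "triadic (Suc m) (3 * k' + i') < triadic (Suc m) (3 * k' + j')" using ij by auto
    then have ab: "a = triadic (Suc m) (3 * k + i)" "b = triadic (Suc m) (3 * k + j)"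
      "c = triadic (Suc m) (3 * k' + i')" "d = triadic (Suc m) (3 * k' + j')"
      using k(2) k'(2) cross by (auto simp: doubleton_eq_iff)
    then have lt: "3 * k + i < 3 * k' + i'" "3 * k' + i' < 3 * k + j" "3 * k + j < 3 * k' + j'"
      using cross by (simp_all only: triadic_less_iff)
    have "k' \<le> k" using lt(2) ij by linarith
    moreover have "k \<le> k'" using lt(3) ij by linarith
    ultimately have kk: "k = k'" by simp
    then have "i < i'" "j < j'" using lt by auto
    then have "i = 0 \<and> j = 2 \<and> i' = 1 \<and> j' = 3" using k(1) k'(1) by auto
    then have "\<not> lower_page {a, b}" "lower_page {c, d}"
      using not_lower_page[of "{a, b}" m k] ab lower_page_def[of "{c, d}"] by auto
    then show ?thesis by blast
  qed
qed

text \<open>This is the graph of \<open>s * (x - a) * (b - x)\<close> over the interval from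
  \<open>a\<close> to \<open>b\<close>, run through at constant horizontal speed. The sign of
  \<open>s\<close> selects the side of the line; with one common absolute value of \<open>s\<close>,
  nested arcs stay apart.\<close>

definition parabola :: "real \<Rightarrow> real \<Rightarrow> real \<Rightarrow> real \<Rightarrow> real \<times> real" where
  "parabola s a b t = (a + t * (b - a), s * (t * (b - a)) * ((1 - t) * (b - a)))"

lemma pathstart_parabola [simp]: "pathstart (parabola s a b) = (a, 0)"
  by (simp add: pathstart_def parabola_def)

lemma pathfinish_parabola [simp]: "pathfinish (parabola s a b) = (b, 0)"
  by (simp add: pathfinish_def parabola_def)

lemma arc_parabola: assumes "a < b" shows "arc (parabola s a b)"
  unfolding arc_def path_def
proof
  show "continuous_on {0..1} (parabola s a b)"
    unfolding parabola_def by (intro continuous_intros)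
  show "inj_on (parabola s a b) {0..1}"
    using assms by (auto simp: inj_on_def parabola_def)
qed

lemma path_image_parabola:
  assumes "(x, y) \<in> path_image (parabola s a b)" "a < b"
  shows "a \<le> x" "x \<le> b" "y = s * ((x - a) * (b - x))"
proof -
  obtain t where t: "0 \<le> t" "t \<le> 1" "x = a + t * (b - a)"
    "y = s * (t * (b - a)) * ((1 - t) * (b - a))"
    using assms(1) by (auto simp: path_image_def parabola_def)
  show "a \<le> x" using t assms by simp
  have "b - x = (1 - t) * (b - a)" using t by (simp add: algebra_simps)
  moreover from this have "b - x \<ge> 0" using t assms by simp
  ultimately show "x \<le> b" "y = s * ((x - a) * (b - x))" using t by auto
qed

text \<open>Above an interior point of the inner interval both factors of the outer product are at
  least the positive inner ones, and one of them is strictly larger unless the intervals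
  coincide.\<close>

lemma nested_parabolas_meet_imp_eq:
  fixes a b c d x :: real
  assumes "(x - a) * (b - x) = (x - c) * (d - x)" "a \<le> c" "c < x" "x < d" "d \<le> b"
  shows "a = c \<and> b = d"
proof (rule ccontr)
  assume "\<not> (a = c \<and> b = d)"
  then consider "a < c" | "d < b" using assms by linarith
  then have "(x - c) * (d - x) < (x - a) * (b - x)"
  proof cases
    case 1
    then show ?thesis using assms by (intro mult_less_le_imp_less) auto
  next
    case 2
    then show ?thesis using assms by (intro mult_le_less_imp_less) auto
  qed
  then show False using assms(1) by simp
qed

lemma whirl_planar: "planar_graph whirl_V whirl_E"
proof -
  define pt :: "rat \<Rightarrow> real \<times> real" where "pt x = (of_rat x, 0)" for x
  define sg :: "rat set \<Rightarrow> real" where "sg e = (if lower_page e then -1 else 1)" for e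
  \<comment> \<open>\<open>Min\<close> and \<open>Max\<close> recover the ordered endpoints from the
    unordered edge.\<close>
  define crv where "crv e = parabola (sg e) (of_rat (Min e)) (of_rat (Max e))" for e
  have crv: "crv {a, b} = parabola (sg {a, b}) (of_rat a) (of_rat b)" if "a < b" for a b
    using that by (simp add: crv_def)
  have interior: "of_rat a < x" "x < of_rat b" "y = sg {a, b} * ((x - of_rat a) * (of_rat b - x))"
    if "a < b" "(x, y) \<in> path_image (crv {a, b}) - pt ` {a, b}" for a b x y
  proof -
    have "(x, y) \<in> path_image (parabola (sg {a, b}) (of_rat a) (of_rat b))"
      using that crv by auto
    note 1 = path_image_parabola[OF this]
    have ab: "(of_rat a::real) < of_rat b" using that of_rat_less by blast
    have "x \<noteq> of_rat a" "x \<noteq> of_rat b" using 1[OF ab] that(2) by (auto simp: pt_def)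
    then show "of_rat a < x" "x < of_rat b"
      "y = sg {a, b} * ((x - of_rat a) * (of_rat b - x))" using 1[OF ab] by auto
  qed
  have sg0: "sg e \<noteq> 0" for e by (simp add: sg_def)
  have "inj_on pt whirl_V" by (auto simp: inj_on_def pt_def)
  moreover have "arc (crv e) \<and> {pathstart (crv e), pathfinish (crv e)} = pt ` e \<and>
        (path_image (crv e) - pt ` e) \<inter> pt ` whirl_V = {}" if E: "e \<in> whirl_E" for e
  proof -
    obtain a b where e: "a < b" "e = {a, b}" using E whirl_E_ordered by blast
    have "(x, y) \<notin> pt ` whirl_V" if "(x, y) \<in> path_image (crv e) - pt ` e" for x y
      using interior[of a b x y] e that sg0[of e] by (auto simp: pt_def)
    moreover have "arc (crv e)" using e crv arc_parabola of_rat_less by metis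
    ultimately show ?thesis using e crv by (auto simp: pt_def)
  qed
  moreover have "(path_image (crv e) - pt ` e) \<inter> path_image (crv e') = {}"
    if E: "e \<in> whirl_E" "e' \<in> whirl_E" "e \<noteq> e'" for e e'
  proof (rule ccontr)
    assume "\<not> ?thesis"
    then obtain x y where xy: "(x, y) \<in> path_image (crv e) - pt ` e" "(x, y) \<in> path_image (crv e')"
      by auto
    obtain a b where e: "a < b" "e = {a, b}" using E whirl_E_ordered by blast
    obtain c d where e': "c < d" "e' = {c, d}" using E whirl_E_ordered by blast
    note 1 = interior[OF e(1), of x y, folded e(2), OF xy(1)]
    \<comment> \<open>Vertices have height 0, so the common point is interior to \<open>e'\<close>
      as well and both arcs can be treated alike.\<close>
    have "y \<noteq> 0" using 1 sg0[of e] by simp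
    then have "(x, y) \<notin> pt ` e'" by (auto simp: pt_def)
    then have "(x, y) \<in> path_image (crv e') - pt ` e'" using xy by blast
    note 2 = interior[OF e'(1), of x y, folded e'(2), OF this]
    have pos: "(x - of_rat a) * (of_rat b - x) > 0" "(x - of_rat c) * (of_rat d - x) > 0"
      using 1 2 by auto
    have "sg e * ((x - of_rat a) * (of_rat b - x)) = sg e' * ((x - of_rat c) * (of_rat d - x))"
      using 1(3) 2(3) by simp
    \<comment> \<open>Arcs on different pages would give the point heights of opposite strict
      signs.\<close>
    then have "lower_page e = lower_page e'"
      and eq: "(x - of_rat a) * (of_rat b - x) = (x - of_rat c) * (of_rat d - x)"
      using pos by (auto simp: sg_def split: if_splits)
    have "of_rat a < (of_rat d::real)" "of_rat c < (of_rat b::real)" using 1 2 by linarith+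
    then have "a < d" "c < b" by (auto simp: of_rat_less)
    \<comment> \<open>Overlapping edges on one page do not interleave, so one interval contains the
      other.\<close>
    then have "(a \<le> c \<and> d \<le> b) \<or> (c \<le> a \<and> b \<le> d)"
      using crossing_edges_on_different_pages[of a b c d] crossing_edges_on_different_pages[of c d a b]
        E e e' \<open>lower_page e = lower_page e'\<close> by force
    then have "(of_rat a = (of_rat c::real) \<and> of_rat b = (of_rat d::real))"
      using nested_parabolas_meet_imp_eq[OF eq] nested_parabolas_meet_imp_eq[OF eq[symmetric]] 1 2
      by (auto simp: of_rat_less_eq)
    then show False using E e e' by simp
  qed
  ultimately show ?thesis unfolding planar_graph_def by blast
qed

section \<open>Paths\<close>

lemma path_edges_simps [simp]:
  "path_edges [] = {}" "path_edges [x] = {}"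
  "path_edges (x # y # zs) = insert {x, y} (path_edges (y # zs))"
proof -
  show "path_edges (x # y # zs) = insert {x, y} (path_edges (y # zs))"
  proof (intro set_eqI iffI)
    fix e assume "e \<in> path_edges (x # y # zs)"
    then obtain i where i: "Suc i < length (x # y # zs)"
      "e = {(x # y # zs) ! i, (x # y # zs) ! Suc i}" by (auto simp: path_edges_def)
    then show "e \<in> insert {x, y} (path_edges (y # zs))"
      by (cases i) (auto simp: path_edges_def)
  next
    fix e assume "e \<in> insert {x, y} (path_edges (y # zs))"
    then consider "e = {x, y}" | i where "Suc i < length (y # zs)"
      "e = {(y # zs) ! i, (y # zs) ! Suc i}" by (auto simp: path_edges_def)
    then show "e \<in> path_edges (x # y # zs)"
    proof cases
      case 1
      then show ?thesis unfolding path_edges_def by (intro CollectI exI[of _ 0]) auto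
    next
      case 2
      then show ?thesis unfolding path_edges_def by (intro CollectI exI[of _ "Suc i"]) auto
    qed
  qed
qed (auto simp: path_edges_def)

lemma path_edges_nth: "Suc i < length p \<Longrightarrow> {p ! i, p ! Suc i} \<in> path_edges p"
  by (auto simp: path_edges_def)

lemma finite_path_edges: "finite (path_edges p)"
proof -
  have "path_edges p \<subseteq> (\<lambda>i. {p ! i, p ! Suc i}) ` {..<length p}" by (auto simp: path_edges_def)
  then show ?thesis using finite_surj by blast
qed

lemma path_edges_subset: "e \<in> path_edges p \<Longrightarrow> e \<subseteq> set p"
  by (auto simp: path_edges_def)

lemma path_edges_append_tl:
  assumes "p \<noteq> []" "q \<noteq> []" "last p = hd q"
  shows "path_edges (p @ tl q) = path_edges p \<union> path_edges q"
  using assms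
proof (induction p rule: induct_list012)
  case (2 x)
  then show ?case by (cases q) auto
qed auto

lemma path_edges_rev: "path_edges (rev p) = path_edges p"
proof (induction p rule: induct_list012)
  case (3 x y zs)
  have "path_edges (rev (x # y # zs)) = path_edges (rev (y # zs) @ tl [y, x])" by simp
  also have "\<dots> = path_edges (rev (y # zs)) \<union> path_edges [y, x]"
    by (rule path_edges_append_tl) auto
  finally show ?case using 3 by auto
qed auto

lemma path_edges_nonempty: "p \<noteq> [] \<Longrightarrow> hd p \<noteq> last p \<Longrightarrow> path_edges p \<noteq> {}"
  by (cases p; cases "tl p") auto

lemma is_uv_path_rev: "is_uv_path V E u v p \<Longrightarrow> is_uv_path V E v u (rev p)"
  by (auto simp: is_uv_path_def path_edges_rev hd_rev last_rev)

lemma edge_disjoint_rev: "edge_disjoint (rev p) (rev q) \<longleftrightarrow> edge_disjoint p q"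
  by (simp add: edge_disjoint_def path_edges_rev)

lemma precedes_in_nth: "i < j \<Longrightarrow> j < length p \<Longrightarrow> precedes_in p (p ! i) (p ! j)"
  unfolding precedes_in_def by blast

lemma precedes_in_rev:
  fixes p :: "'a list"
  shows "precedes_in (rev p) x y \<longleftrightarrow> precedes_in p y x"
proof -
  have "precedes_in p y x" if "precedes_in (rev p) x y" for p :: "'a list" and x y
  proof -
    obtain i j where ij: "i < j" "j < length p" "rev p ! i = x" "rev p ! j = y"
      using \<open>precedes_in (rev p) x y\<close> by (auto simp: precedes_in_def)
    then have "p ! (length p - Suc i) = x" "p ! (length p - Suc j) = y"
      by (simp_all add: rev_nth)
    then show ?thesis unfolding precedes_in_def
      using ij by (intro exI[of _ "length p - Suc j"] exI[of _ "length p - Suc i"]) auto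
  qed
  from this[of p x y] this[of "rev p" y x] show ?thesis by auto
qed

lemma order_compatible_rev: "order_compatible (rev p) (rev q) \<longleftrightarrow> order_compatible p q"
  by (auto simp: order_compatible_def precedes_in_rev)

lemma pairwise_rev_image:
  assumes "pairwise R P" "\<And>p q. R p q \<Longrightarrow> R (rev p) (rev q)"
  shows "pairwise R (rev ` P)"
  using assms by (auto simp: pairwise_def)

lemma precedes_in_distinct:
  assumes "distinct p" "precedes_in p x y" shows "\<not> precedes_in p y x"
proof
  assume "precedes_in p y x"
  then obtain i j where 1: "i < j" "j < length p" "p ! i = y" "p ! j = x"
    by (auto simp: precedes_in_def)
  obtain i' j' where 2: "i' < j'" "j' < length p" "p ! i' = x" "p ! j' = y"
    using assms by (auto simp: precedes_in_def)
  have "i = j'" "j = i'" using 1 2 assms(1) nth_eq_iff_index_eq[of p] by fastforce+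
  then show False using 1 2 by simp
qed

text \<open>The right-hand side depends on the list only through its set of vertices, so any two
  paths increasing for the same rank \<open>r\<close> are order-compatible.\<close>

lemma precedes_in_sorted_wrt:
  fixes r :: "'a \<Rightarrow> 'b::linorder"
  assumes "sorted_wrt (\<lambda>x y. r x < r y) p"
  shows "precedes_in p x y \<longleftrightarrow> x \<in> set p \<and> y \<in> set p \<and> r x < r y"
proof
  assume "precedes_in p x y"
  then show "x \<in> set p \<and> y \<in> set p \<and> r x < r y"
    using assms by (force simp: precedes_in_def sorted_wrt_iff_nth_less)
next
  assume *: "x \<in> set p \<and> y \<in> set p \<and> r x < r y"
  then obtain i j where ij: "i < length p" "j < length p" "p ! i = x" "p ! j = y"
    by (meson in_set_conv_nth)
  have "i < j"
  proof (rule ccontr)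
    assume "\<not> i < j"
    then have "i = j \<or> j < i" by auto
    then have "r y = r x \<or> r y < r x" using ij assms by (auto simp: sorted_wrt_iff_nth_less)
    then show False using * by auto
  qed
  then show "precedes_in p x y" using ij by (auto simp: precedes_in_def)
qed

section \<open>Finitely many paths\<close>

text \<open>The rank replaces the numerical order, since a zigzag runs backwards on its middle edge.
  Confinement to \<open>{a..b}\<close> keeps paths over adjacent intervals edge-disjoint.\<close>

definition ranked_path :: "(rat \<Rightarrow> rat) \<Rightarrow> rat \<Rightarrow> rat \<Rightarrow> rat list \<Rightarrow> bool" where
  "ranked_path r a b p \<longleftrightarrow> p \<noteq> [] \<and> hd p = a \<and> last p = b \<and> set p \<subseteq> {a..b} \<inter> whirl_V \<and>
     sorted_wrt (\<lambda>x y. r x < r y) p \<and> path_edges p \<subseteq> whirl_E"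

text \<open>A common rank function that increases along all the paths makes them pairwise
  order-compatible. Fixing it at the endpoints lets the rank functions of adjacent intervals be
  glued.\<close>

definition path_bundle :: "nat \<Rightarrow> rat \<Rightarrow> rat \<Rightarrow> bool" where
  "path_bundle k a b \<longleftrightarrow> (\<exists>r f. r a = a \<and> r b = b \<and> (\<forall>i<k. ranked_path r a b (f i)) \<and>
     (\<forall>i<k. \<forall>j<k. i \<noteq> j \<longrightarrow> edge_disjoint (f i) (f j)))"

lemma ranked_path_cong:
  assumes "ranked_path r a b p" "\<And>x. x \<in> {a..b} \<Longrightarrow> r x = r' x"
  shows "ranked_path r' a b p"
proof -
  have "r x = r' x" if "x \<in> set p" for x using assms that by (auto simp: ranked_path_def)
  then have "sorted_wrt (\<lambda>x y. r' x < r' y) p"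
    using assms(1) sorted_wrt_mono_rel[of p "\<lambda>x y. r x < r y" "\<lambda>x y. r' x < r' y"]
    by (auto simp: ranked_path_def)
  then show ?thesis using assms(1) by (auto simp: ranked_path_def)
qed

lemma ranked_path_append:
  assumes p: "ranked_path r a b p" and q: "ranked_path r b c q" and "a \<le> b" "b \<le> c"
  shows "ranked_path r a c (p @ tl q)" "path_edges (p @ tl q) = path_edges p \<union> path_edges q"
proof -
  \<comment> \<open>Exposing \<open>b\<close> at the end of \<open>p\<close> and at the start of
    \<open>q\<close> lets the ranks of the two parts be compared through \<open>r b\<close>.\<close>
  obtain q' where q': "q = b # q'" using q by (cases q) (auto simp: ranked_path_def)
  obtain p' where p': "p = p' @ [b]"
    using p by (cases p rule: rev_cases) (auto simp: ranked_path_def)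
  show e: "path_edges (p @ tl q) = path_edges p \<union> path_edges q"
    by (rule path_edges_append_tl) (use p q in \<open>auto simp: ranked_path_def\<close>)
  have "sorted_wrt (\<lambda>x y. r x < r y) (p @ q')"
    using p q unfolding p' q'
    by (auto simp: ranked_path_def sorted_wrt_append intro: less_trans)
  moreover have "last (p @ q') = c" using q p by (auto simp: q' ranked_path_def split: if_splits)
  moreover have "set (p @ q') \<subseteq> {a..c} \<inter> whirl_V"
  proof -
    have "{a..b} \<subseteq> {a..c}" "{b..c} \<subseteq> {a..c}" using assms(3,4) by auto
    moreover have "set p \<subseteq> {a..b} \<inter> whirl_V" "set q' \<subseteq> {b..c} \<inter> whirl_V"
      using p q by (simp_all add: ranked_path_def q')
    ultimately show ?thesis by auto
  qed
  ultimately show "ranked_path r a c (p @ tl q)"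
    using e p q by (auto simp: q' ranked_path_def)
qed

lemma ranked_path_edge:
  assumes "ranked_path r a b p" "e \<in> path_edges p"
  shows "e \<subseteq> {a..b}" "card e = 2"
proof -
  show "e \<subseteq> {a..b}" using assms path_edges_subset by (fastforce simp: ranked_path_def)
  show "card e = 2" using assms whirl_simple_graph by (auto simp: ranked_path_def simple_graph_def)
qed

lemma ranked_path_single_edge:
  assumes "{a, b} \<in> whirl_E" "a < b" "r a = a" "r b = b"
  shows "ranked_path r a b [a, b]"
  using assms whirl_simple_graph by (auto simp: ranked_path_def simple_graph_def)

text \<open>The two intervals share at most one point, but an edge has two vertices.\<close>

lemma adjacent_ranked_paths_edge_disjoint:
  assumes "ranked_path r a b p" "ranked_path r' c d q" "b \<le> c"
  shows "path_edges p \<inter> path_edges q = {}"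
proof (rule ccontr)
  assume "\<not> ?thesis"
  then obtain e where "e \<in> path_edges p" "e \<in> path_edges q" by blast
  then have "e \<subseteq> {a..b}" "e \<subseteq> {c..d}" "card e = 2" using assms ranked_path_edge by blast+
  then have "e \<subseteq> {b}" using assms(3) by fastforce
  then have "card e \<le> 1" using card_mono[of "{b}" e] by simp
  then show False using \<open>card e = 2\<close> by simp
qed

lemma path_bundle_append:
  assumes "path_bundle k a b" "path_bundle k b c" "a < b" "b < c"
  shows "path_bundle k a c"
proof -
  obtain r f where f: "r a = a" "r b = b" "\<And>i. i < k \<Longrightarrow> ranked_path r a b (f i)"
    "\<And>i j. i < k \<Longrightarrow> j < k \<Longrightarrow> i \<noteq> j \<Longrightarrow> path_edges (f i) \<inter> path_edges (f j) = {}"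
    using assms(1) unfolding path_bundle_def edge_disjoint_def by metis
  obtain r' g where g: "r' b = b" "r' c = c" "\<And>i. i < k \<Longrightarrow> ranked_path r' b c (g i)"
    "\<And>i j. i < k \<Longrightarrow> j < k \<Longrightarrow> i \<noteq> j \<Longrightarrow> path_edges (g i) \<inter> path_edges (g j) = {}"
    using assms(2) unfolding path_bundle_def edge_disjoint_def by metis
  \<comment> \<open>The two ranks agree at the joint, as both send \<open>b\<close> to
    \<open>b\<close>.\<close>
  define s where "s x = (if x \<le> b then r x else r' x)" for x
  have sf: "ranked_path s a b (f i)" if "i < k" for i
    by (rule ranked_path_cong[OF f(3)[OF that]]) (auto simp: s_def)
  have sg: "ranked_path s b c (g i)" if "i < k" for i
    by (rule ranked_path_cong[OF g(3)[OF that]]) (use f g in \<open>auto simp: s_def\<close>)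
  define h where "h i = f i @ tl (g i)" for i
  have h: "ranked_path s a c (h i)" "path_edges (h i) = path_edges (f i) \<union> path_edges (g i)"
    if "i < k" for i
    using ranked_path_append[OF sf[OF that] sg[OF that]] assms by (auto simp: h_def)
  have fg: "path_edges (f i) \<inter> path_edges (g j) = {}" if "i < k" "j < k" for i j
    using adjacent_ranked_paths_edge_disjoint[OF sf sg] that by blast
  have "edge_disjoint (h i) (h j)" if "i < k" "j < k" "i \<noteq> j" for i j
    using that h(2)[of i] h(2)[of j] f(4)[of i j] g(4)[of i j] fg[of i j] fg[of j i]
    unfolding edge_disjoint_def by auto
  moreover have "s a = a" "s c = c" using f g assms by (auto simp: s_def)
  ultimately show ?thesis
    using h(1) unfolding path_bundle_def by (intro exI[of _ s] exI[of _ h]) auto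
qed

text \<open>One path uses the edge \<open>{a, s}\<close> to skip the first two thirds and another uses \<open>{t, b}\<close>
  to skip the last two, so the bundle over the whole interval has one path more than the
  bundles over its thirds.\<close>

lemma path_bundle_step:
  assumes "path_bundle (Suc k) a t" "path_bundle (Suc k) t s" "path_bundle (Suc k) s b"
    and less: "a < t" "t < s" "s < b" and E: "{a, s} \<in> whirl_E" "{t, b} \<in> whirl_E"
  shows "path_bundle (Suc (Suc k)) a b"
proof -
  obtain rA A where A: "rA a = a" "rA t = t" "\<And>i. i < Suc k \<Longrightarrow> ranked_path rA a t (A i)"
    "\<And>i j. i < Suc k \<Longrightarrow> j < Suc k \<Longrightarrow> i \<noteq> j \<Longrightarrow> path_edges (A i) \<inter> path_edges (A j) = {}"
    using assms(1) unfolding path_bundle_def edge_disjoint_def by metis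
  obtain rB B where B: "rB t = t" "rB s = s" "\<And>i. i < Suc k \<Longrightarrow> ranked_path rB t s (B i)"
    "\<And>i j. i < Suc k \<Longrightarrow> j < Suc k \<Longrightarrow> i \<noteq> j \<Longrightarrow> path_edges (B i) \<inter> path_edges (B j) = {}"
    using assms(2) unfolding path_bundle_def edge_disjoint_def by metis
  obtain rC C where C: "rC s = s" "rC b = b" "\<And>i. i < Suc k \<Longrightarrow> ranked_path rC s b (C i)"
    "\<And>i j. i < Suc k \<Longrightarrow> j < Suc k \<Longrightarrow> i \<noteq> j \<Longrightarrow> path_edges (C i) \<inter> path_edges (C j) = {}"
    using assms(3) unfolding path_bundle_def edge_disjoint_def by metis
  define r where "r x = (if x \<le> t then rA x else if x \<le> s then rB x else rC x)" for x
  have r: "r a = a" "r t = t" "r s = s" "r b = b" using A B C less by (auto simp: r_def)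
  have rA: "ranked_path r a t (A i)" if "i < Suc k" for i
    by (rule ranked_path_cong[OF A(3)[OF that]]) (auto simp: r_def)
  have rB: "ranked_path r t s (B i)" if "i < Suc k" for i
    by (rule ranked_path_cong[OF B(3)[OF that]]) (use A B less in \<open>auto simp: r_def\<close>)
  have rC: "ranked_path r s b (C i)" if "i < Suc k" for i
    by (rule ranked_path_cong[OF C(3)[OF that]]) (use B C less in \<open>auto simp: r_def\<close>)
  have edge_as: "ranked_path r a s [a, s]" using ranked_path_single_edge E r less by simp
  have edge_tb: "ranked_path r t b [t, b]" using ranked_path_single_edge E r less by simp
  \<comment> \<open>Index 0 takes the edge \<open>{a, s}\<close> and then \<open>C 0\<close>; index
    \<open>Suc k\<close> takes \<open>A 0\<close> and then \<open>{t, b}\<close>. The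
    \<open>k\<close> indices between them run through all three thirds, so each path of a third is
    used at most once.\<close>
  define h where "h i = (if i = 0 then [a, s] @ tl (C 0) else if i = Suc k then A 0 @ tl [t, b]
    else (A i @ tl (B i)) @ tl (C i))" for i
  have h0: "ranked_path r a b (h 0)" "path_edges (h 0) = {{a, s}} \<union> path_edges (C 0)"
    using ranked_path_append[OF edge_as rC, of 0] less by (auto simp: h_def)
  have hk: "ranked_path r a b (h (Suc k))" "path_edges (h (Suc k)) = path_edges (A 0) \<union> {{t, b}}"
    using ranked_path_append[OF rA edge_tb, of 0] less by (auto simp: h_def)
  have h: "ranked_path r a b (h i)"
    "path_edges (h i) = path_edges (A i) \<union> path_edges (B i) \<union> path_edges (C i)"
    if "0 < i" "i < Suc k" for i
    using ranked_path_append[OF ranked_path_append(1)[OF rA rB] rC, of i i i]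
      ranked_path_append(2)[OF rA rB, of i i] less that by (auto simp: h_def)
  have AB: "path_edges (A i) \<inter> path_edges (B j) = {}" if "i < Suc k" "j < Suc k" for i j
    using adjacent_ranked_paths_edge_disjoint[OF rA rB] that by blast
  have BC: "path_edges (B i) \<inter> path_edges (C j) = {}" if "i < Suc k" "j < Suc k" for i j
    using adjacent_ranked_paths_edge_disjoint[OF rB rC] that by blast
  have AC: "path_edges (A i) \<inter> path_edges (C j) = {}" if "i < Suc k" "j < Suc k" for i j
    using adjacent_ranked_paths_edge_disjoint[OF rA rC] that less by simp
  \<comment> \<open>Neither long edge fits inside a single third.\<close>
  have new: "{a, s} \<notin> path_edges (A i)" "{a, s} \<notin> path_edges (B i)" "{a, s} \<notin> path_edges (C i)"
    "{t, b} \<notin> path_edges (A i)" "{t, b} \<notin> path_edges (B i)" "{t, b} \<notin> path_edges (C i)"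
    if "i < Suc k" for i
    using ranked_path_edge(1)[OF rA[OF that]] ranked_path_edge(1)[OF rB[OF that]]
      ranked_path_edge(1)[OF rC[OF that]] less by fastforce+
  have ne: "{a, s} \<noteq> {t, b}" using less by (auto simp: doubleton_eq_iff)
  have d0k: "edge_disjoint (h 0) (h (Suc k))"
    using h0(2) hk(2) AC[of 0 0] new[of 0] ne unfolding edge_disjoint_def by auto
  have d0: "edge_disjoint (h 0) (h i)" if "0 < i" "i < Suc k" for i
    using h0(2) h(2)[OF that] AC[of i 0] BC[of i 0] C(4)[of 0 i] new[of i] that
    unfolding edge_disjoint_def by auto
  have dk: "edge_disjoint (h (Suc k)) (h i)" if "0 < i" "i < Suc k" for i
    using hk(2) h(2)[OF that] AC[of 0 i] AB[of 0 i] A(4)[of 0 i] new[of i] that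
    unfolding edge_disjoint_def by auto
  have dd: "edge_disjoint (h i) (h j)" if "0 < i" "i < Suc k" "0 < j" "j < Suc k" "i \<noteq> j" for i j
    using h(2)[of i] h(2)[of j] AB[of i j] AB[of j i] AC[of i j] AC[of j i] BC[of i j] BC[of j i]
      A(4)[of i j] B(4)[of i j] C(4)[of i j] that
    unfolding edge_disjoint_def by auto
  have sym: "edge_disjoint p q \<Longrightarrow> edge_disjoint q p" for p q :: "rat list"
    by (auto simp: edge_disjoint_def)
  have cases: "i = 0 \<or> i = Suc k \<or> (0 < i \<and> i < Suc k)" if "i < Suc (Suc k)" for i
    using that by linarith
  have "edge_disjoint (h i) (h j)" if "i < Suc (Suc k)" "j < Suc (Suc k)" "i \<noteq> j" for i j
    using cases[OF that(1)] cases[OF that(2)] that(3) d0k d0 dk dd sym by metis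
  moreover have "ranked_path r a b (h i)" if "i < Suc (Suc k)" for i
    using cases[OF that] h0(1) hk(1) h(1) by blast
  ultimately show ?thesis
    using r(1,4) unfolding path_bundle_def by (intro exI[of _ r] exI[of _ h]) auto
qed

lemma path_bundle_1:
  assumes "a < t" "t < s" "s < b" "{a, s} \<in> whirl_E" "{t, s} \<in> whirl_E" "{t, b} \<in> whirl_E"
  shows "path_bundle 1 a b"
proof -
  \<comment> \<open>The path is the zigzag \<open>a, s, t, b\<close>, so the rank swaps
    \<open>t\<close> and \<open>s\<close>.\<close>
  define r where "r x = (if x = t then s else if x = s then t else x)" for x
  have "{a, t, s, b} \<subseteq> whirl_V" using assms whirl_simple_graph by (auto simp: simple_graph_def)
  then have "ranked_path r a b [a, s, t, b]"
    using assms by (auto simp: ranked_path_def r_def insert_commute)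
  moreover have "r a = a" "r b = b" using assms by (auto simp: r_def)
  ultimately show ?thesis unfolding path_bundle_def by (intro exI[of _ r] exI[of _ "\<lambda>_. [a, s, t, b]"]) auto
qed

text \<open>Each further path costs one more subdivision: the induction on \<open>k\<close> passes
  to the thirds at level \<open>Suc m\<close>, so \<open>m\<close> and \<open>j\<close> must
  vary.\<close>

lemma path_bundle_cell: "j < 3 ^ m \<Longrightarrow> path_bundle (Suc k) (triadic m j) (triadic m (Suc j))"
proof (induction k arbitrary: m j)
  case (0 m j)
  have "{triadic (Suc m) (3 * j + i), triadic (Suc m) (3 * j + l)} \<in> whirl_E"
    if "(i, l) \<in> {(0, 2), (1, 2), (1, 3)}" for i l
    using 0 that by (intro whirl_EnI[of _ m]) (auto simp: whirl_En_iff)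
  from this[of 0 2] this[of 1 2] this[of 1 3]
  have "path_bundle 1 (triadic (Suc m) (3 * j)) (triadic (Suc m) (3 * j + 3))"
    by (intro path_bundle_1[of _ "triadic (Suc m) (3 * j + 1)" "triadic (Suc m) (3 * j + 2)"]) simp_all
  then show ?case unfolding triadic_Suc[of m] by (simp add: add.commute)
next
  case (Suc k m j)
  have "{triadic (Suc m) (3 * j + i), triadic (Suc m) (3 * j + l)} \<in> whirl_E"
    if "(i, l) \<in> {(0, 2), (1, 2), (1, 3)}" for i l
    using Suc.prems that by (intro whirl_EnI[of _ m]) (auto simp: whirl_En_iff)
  note E = this[of 0 2] this[of 1 3]
  have sub: "path_bundle (Suc k) (triadic (Suc m) (3 * j + i)) (triadic (Suc m) (Suc (3 * j + i)))"
    if "i < 3" for i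
    using Suc.prems that by (intro Suc.IH) simp
  have "path_bundle (Suc (Suc k)) (triadic (Suc m) (3 * j)) (triadic (Suc m) (3 * Suc j))"
  proof (rule path_bundle_step)
    show "path_bundle (Suc k) (triadic (Suc m) (3 * j)) (triadic (Suc m) (3 * j + 1))"
      "path_bundle (Suc k) (triadic (Suc m) (3 * j + 1)) (triadic (Suc m) (3 * j + 2))"
      using sub[of 0] sub[of 1] by simp_all
    have "Suc (3 * j + 2) = 3 * Suc j" "(2::nat) < 3" by simp_all
    then show "path_bundle (Suc k) (triadic (Suc m) (3 * j + 2)) (triadic (Suc m) (3 * Suc j))"
      using sub[of 2] by metis
    show "{triadic (Suc m) (3 * j), triadic (Suc m) (3 * j + 2)} \<in> whirl_E" using E(1) by simp
    have "3 * j + 3 = 3 * Suc j" by simp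
    then show "{triadic (Suc m) (3 * j + 1), triadic (Suc m) (3 * Suc j)} \<in> whirl_E"
      using E(2) by (metis insertI1 insertI2)
  qed simp_all
  then show ?case unfolding triadic_Suc[of m] by simp
qed

lemma path_bundle_triadic:
  assumes "i < j" "j \<le> 3 ^ m" shows "path_bundle (Suc k) (triadic m i) (triadic m j)"
  using assms
proof (induction j)
  case (Suc j)
  then have cell: "path_bundle (Suc k) (triadic m j) (triadic m (Suc j))" using path_bundle_cell by simp
  show ?case
  proof (cases "i = j")
    case True
    then show ?thesis using cell by simp
  next
    case False
    then show ?thesis using Suc cell path_bundle_append by simp
  qed
qed simp

lemma finitely_many_paths_less:
  assumes "u \<in> whirl_V" "v \<in> whirl_V" "u < v"
  shows "\<exists>P. finite P \<and> card P = k \<and> (\<forall>p\<in>P. is_uv_path whirl_V whirl_E u v p) \<and>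
    pairwise edge_disjoint P \<and> pairwise order_compatible P"
proof -
  obtain m where "u \<in> whirl_Vn m" "v \<in> whirl_Vn m" using assms whirl_V_common_level by blast
  then obtain i j where "u = triadic m i" "v = triadic m j" "j \<le> 3 ^ m"
    by (auto simp: whirl_Vn_iff)
  \<comment> \<open>Bundles are available in sizes \<open>Suc k\<close> only; the first
    \<open>k\<close> paths are kept, which includes the case of size 0.\<close>
  then have "path_bundle (Suc k) u v" using assms path_bundle_triadic by simp
  then obtain r f where f: "\<And>i. i < Suc k \<Longrightarrow> ranked_path r u v (f i)"
    "\<And>i j. i < Suc k \<Longrightarrow> j < Suc k \<Longrightarrow> i \<noteq> j \<Longrightarrow> edge_disjoint (f i) (f j)"
    unfolding path_bundle_def by metis
  \<comment> \<open>A path with an edge is not edge-disjoint from itself. Hence \<open>f\<close> is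
    injective and its image has exactly \<open>k\<close> elements.\<close>
  have ne: "path_edges (f i) \<noteq> {}" if "i < k" for i
    using f(1)[of i] that assms path_edges_nonempty[of "f i"] by (auto simp: ranked_path_def)
  have inj: "inj_on f {..<k}"
  proof (rule inj_onI, rule ccontr)
    fix i j assume ij: "i \<in> {..<k}" "j \<in> {..<k}" "f i = f j" "i \<noteq> j"
    then have "edge_disjoint (f i) (f i)" using f(2)[of i j] by simp
    then show False using ne[of i] ij by (simp add: edge_disjoint_def)
  qed
  have "is_uv_path whirl_V whirl_E u v p" if p: "ranked_path r u v p" for p
  proof -
    have "distinct p" using p unfolding ranked_path_def sorted_wrt_iff_nth_less distinct_conv_nth
      by (metis less_irrefl linorder_neqE_nat)
    then show ?thesis using p by (auto simp: ranked_path_def is_uv_path_def)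
  qed
  moreover have "order_compatible p q" if "ranked_path r u v p" "ranked_path r u v q" for p q
    using that by (auto simp: order_compatible_def ranked_path_def precedes_in_sorted_wrt)
  ultimately show ?thesis
    using f inj
    by (intro exI[of _ "f ` {..<k}"]) (auto simp: card_image pairwise_def intro!: f(2))
qed

text \<open>Reversing every path exchanges the ends and preserves edge-disjointness and
  order-compatibility, which reduces the claim to \<open>u < v\<close>.\<close>

lemma finitely_many_paths:
  assumes "u \<in> whirl_V" "v \<in> whirl_V" "u \<noteq> v"
  shows "\<exists>P. finite P \<and> card P = k \<and> (\<forall>p\<in>P. is_uv_path whirl_V whirl_E u v p) \<and>
    pairwise edge_disjoint P \<and> pairwise order_compatible P"
proof (cases "u < v")
  case True
  then show ?thesis using assms finitely_many_paths_less by blast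
next
  case False
  then obtain P where P: "finite P" "card P = k" "\<forall>p\<in>P. is_uv_path whirl_V whirl_E v u p"
    "pairwise edge_disjoint P" "pairwise order_compatible P"
    using assms finitely_many_paths_less[of v u k] by (metis linorder_less_linear)
  have "card (rev ` P) = k" using P(2) by (simp add: card_image inj_on_def)
  moreover have "\<forall>p\<in>rev ` P. is_uv_path whirl_V whirl_E u v p"
    using P(3) by (auto intro: is_uv_path_rev)
  ultimately show ?thesis
    using P
    by (intro exI[of _ "rev ` P"])
      (auto intro!: pairwise_rev_image simp: edge_disjoint_rev order_compatible_rev)
qed

section \<open>No infinite family of paths\<close>

text \<open>A discrete intermediate value theorem: a path that never jumps over \<open>c\<close> can
  change sides only by landing on \<open>c\<close>.\<close>

lemma path_hits_uncrossed_vertex: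
  fixes p :: "'a::linorder list"
  assumes cross: "\<And>l. Suc l < length p \<Longrightarrow>
      \<not> (p ! l < c \<and> c < p ! Suc l) \<and> \<not> (p ! Suc l < c \<and> c < p ! l)"
    and "i \<le> j" "j < length p" "(p ! i \<le> c \<and> c \<le> p ! j) \<or> (c \<le> p ! i \<and> p ! j \<le> c)"
  shows "\<exists>l\<in>{i..j}. p ! l = c"
  using assms(2-)
proof (induction j rule: dec_induct)
  case base
  then show ?case by force
next
  case (step j)
  show ?case
  proof (cases "p ! Suc j = c")
    case True
    then show ?thesis using step by auto
  next
    case False
    then have "(p ! i \<le> c \<and> c \<le> p ! j) \<or> (c \<le> p ! i \<and> p ! j \<le> c)"
      using step.prems cross[of j] by force
    then show ?thesis using step by force
  qed
qed

lemma fine_path_uncrossed: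
  assumes "path_edges p \<subseteq> whirl_E" "path_edges p \<inter> (\<Union>l\<in>{1..n}. whirl_En l) = {}"
    and "c \<in> whirl_Vn n" "Suc l < length p"
  shows "\<not> (p ! l < c \<and> c < p ! Suc l) \<and> \<not> (p ! Suc l < c \<and> c < p ! l)"
proof -
  have e: "{p ! l, p ! Suc l} \<in> path_edges p" using assms(4) by (rule path_edges_nth)
  then obtain m where m: "{p ! l, p ! Suc l} \<in> whirl_En (Suc m)"
    using assms(1) whirl_E_cases by blast
  then have "\<not> Suc m \<le> n" using e assms(2) by force
  then have "c \<in> whirl_Vn m" using assms(3) whirl_Vn_mono[of n m] by auto
  then show ?thesis using whirl_En_no_straddle m by (metis insert_commute)
qed

text \<open>Coming back from a point below \<open>u\<close>, or going out to a point above
  \<open>v\<close>, the path would visit \<open>u\<close> or \<open>v\<close> at a second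
  position.\<close>

lemma fine_path_in_interval:
  assumes p: "is_uv_path whirl_V whirl_E u v p"
    and fine: "path_edges p \<inter> (\<Union>l\<in>{1..n}. whirl_En l) = {}"
    and uv: "u \<in> whirl_Vn n" "v \<in> whirl_Vn n" "u < v"
  shows "set p \<subseteq> {u..v}"
proof
  fix x assume "x \<in> set p"
  then obtain i where i: "i < length p" "p ! i = x" by (meson in_set_conv_nth)
  have pp: "p \<noteq> []" "p ! 0 = u" "p ! (length p - 1) = v" "distinct p" "path_edges p \<subseteq> whirl_E"
    using p by (auto simp: is_uv_path_def hd_conv_nth last_conv_nth)
  note hits = path_hits_uncrossed_vertex[OF fine_path_uncrossed[OF pp(5) fine]]
  have "\<not> x < u"
  proof
    assume "x < u"
    then have "\<exists>l\<in>{i..length p - 1}. p ! l = u"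
      using i pp uv by (intro hits) auto
    then obtain l where "i \<le> l" "l < length p" "p ! l = u" using pp(1) i(1) by fastforce
    moreover have "i \<noteq> 0" using i(2) pp(2) \<open>x < u\<close> by (metis less_irrefl)
    ultimately show False using pp nth_eq_iff_index_eq[OF pp(4), of l 0] by auto
  qed
  moreover have "\<not> v < x"
  proof
    assume "v < x"
    then have "\<exists>l\<in>{0..i}. p ! l = v"
      using i pp uv by (intro hits) auto
    then obtain l where "l \<le> i" "p ! l = v" by auto
    moreover have "i \<noteq> length p - 1" using i(2) pp(3) \<open>v < x\<close> by (metis less_irrefl)
    ultimately show False using pp i nth_eq_iff_index_eq[OF pp(4), of l "length p - 1"] by auto
  qed
  ultimately show "x \<in> {u..v}" by auto
qed

text \<open>The path must land on \<open>y\<close>, and its initial piece from \<open>u\<close> to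
  \<open>y\<close> must already land on \<open>x\<close>.\<close>

lemma fine_path_increasing:
  assumes p: "is_uv_path whirl_V whirl_E u v p"
    and fine: "path_edges p \<inter> (\<Union>l\<in>{1..n}. whirl_En l) = {}"
    and xy: "x \<in> whirl_Vn n" "y \<in> whirl_Vn n" "u \<le> x" "x < y" "y \<le> v"
  shows "precedes_in p x y"
proof -
  have pp: "p \<noteq> []" "p ! 0 = u" "p ! (length p - 1) = v" "distinct p" "path_edges p \<subseteq> whirl_E"
    using p by (auto simp: is_uv_path_def hd_conv_nth last_conv_nth)
  note hits = path_hits_uncrossed_vertex[OF fine_path_uncrossed[OF pp(5) fine]]
  have "\<exists>l\<in>{0..length p - 1}. p ! l = y" using pp xy by (intro hits) auto
  then obtain j where j: "j < length p" "p ! j = y" using pp(1) by (metis atLeastAtMost_iff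
    Suc_pred' length_greater_0_conv less_Suc_eq_le)
  have "\<exists>l\<in>{0..j}. p ! l = x" using pp xy j by (intro hits) auto
  then obtain i where "i \<le> j" "p ! i = x" by auto
  moreover have "i \<noteq> j" using j xy \<open>p ! i = x\<close> by auto
  ultimately show ?thesis using j unfolding precedes_in_def by (metis le_neq_implies_less)
qed

text \<open>In a zigzag of level \<open>Suc m\<close> the point \<open>3 * k + 1\<close> has both
  neighbours on its right and \<open>3 * k + 2\<close> both on its left. Neither lies in
  \<open>whirl_Vn m\<close>, so coarser edges do not reach them, and every edge of the zigzag
  contains one of the two.\<close>

lemma fresh_vertex_one_sided:
  assumes "e \<in> whirl_En (Suc m)"
  obtains x where "x \<in> e" "x \<notin> whirl_Vn m"
    "(\<forall>l\<le>m. \<forall>y. {x, y} \<in> whirl_En (Suc l) \<longrightarrow> y < x) \<or>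
     (\<forall>l\<le>m. \<forall>y. {x, y} \<in> whirl_En (Suc l) \<longrightarrow> x < y)"
proof -
  obtain k i j where k: "(i, j) \<in> {(0, 2), (1, 2), (1, 3::nat)}"
    "e = {triadic (Suc m) (3 * k + i), triadic (Suc m) (3 * k + j)}"
    using assms whirl_En_cases by metis
  define s where "s = (if i = 1 then 1 else 2::nat)"
  define x where "x = triadic (Suc m) (3 * k + s)"
  have xe: "x \<in> e" using k by (auto simp: x_def s_def)
  have s: "s = 1 \<or> s = 2" by (simp add: s_def)
  have xV: "x \<notin> whirl_Vn m"
  proof
    assume "x \<in> whirl_Vn m"
    then obtain t where "x = triadic (Suc m) (3 * t)" by (auto simp: whirl_Vn_iff triadic_Suc[of m])
    then have "3 * k + s = 3 * t" unfolding x_def by (simp only: triadic_eq_iff)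
    then show False using s by presburger
  qed
  have side: "if s = 2 then y < x else x < y" if "{x, y} \<in> whirl_En (Suc l)" "l \<le> m" for l y
  proof -
    have "l = m"
    proof (rule ccontr)
      assume "l \<noteq> m"
      then have "x \<in> whirl_Vn m"
        using that whirl_En_subset[of "{x, y}" l] whirl_Vn_mono[of "Suc l" m] by auto
      then show False using xV by blast
    qed
    then obtain k' i' j' where k': "(i', j') \<in> {(0, 2), (1, 2), (1, 3::nat)}"
      "{x, y} = {triadic (Suc m) (3 * k' + i'), triadic (Suc m) (3 * k' + j')}"
      using \<open>{x, y} \<in> whirl_En (Suc l)\<close> whirl_En_cases by metis
    then consider "3 * k + s = 3 * k' + i'" "y = triadic (Suc m) (3 * k' + j')"
      | "3 * k + s = 3 * k' + j'" "y = triadic (Suc m) (3 * k' + i')"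
      \<comment> \<open>Modulo 3, a smaller endpoint has residue 0 or 1 and a larger one 2 or 0,
        while \<open>s\<close> is 1 or 2. So \<open>x\<close> is a smaller endpoint only for
        \<open>s = 1\<close> and a larger one only for \<open>s = 2\<close>.\<close>
      unfolding x_def doubleton_eq_iff triadic_eq_iff by blast
    then show ?thesis
    proof cases
      case 1
      have "i' = s \<and> k' = k \<and> s = 1" using 1(1) k'(1) s by auto presburger+
      then show ?thesis using 1 k'(1) by (auto simp: x_def)
    next
      case 2
      have "j' = s \<and> k' = k \<and> s = 2" using 2(1) k'(1) s by auto presburger+
      then show ?thesis using 2 k'(1) by (auto simp: x_def)
    qed
  qed
  then show thesis using that[OF xe xV] by (cases "s = 2") auto
qed

text \<open>Otherwise picking from each path an edge in \<open>S\<close> would inject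
  \<open>P\<close> into the finite set \<open>S\<close>.\<close>

lemma infinite_edge_disjoint_avoid:
  assumes "infinite P" "pairwise edge_disjoint P" "finite S"
  obtains p where "p \<in> P" "path_edges p \<inter> S = {}"
proof (rule ccontr)
  assume "\<not> thesis"
  then have "\<forall>p\<in>P. \<exists>e. e \<in> path_edges p \<inter> S" using that by blast
  then obtain g where g: "\<And>p. p \<in> P \<Longrightarrow> g p \<in> path_edges p \<inter> S" by metis
  have "inj_on g P"
    using g assms(2) unfolding inj_on_def pairwise_def edge_disjoint_def by (metis IntD1 IntI empty_iff)
  moreover have "g ` P \<subseteq> S" using g by blast
  ultimately show False using assms finite_subset finite_imageD by blast
qed

lemma no_infinite_family_less:
  assumes V: "u \<in> whirl_V" "v \<in> whirl_V" "u < v" and "infinite P"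
    and paths: "\<forall>p\<in>P. is_uv_path whirl_V whirl_E u v p"
    and ed: "pairwise edge_disjoint P" and oc: "pairwise order_compatible P"
  shows False
proof -
  obtain n where n: "u \<in> whirl_Vn n" "v \<in> whirl_Vn n" using V whirl_V_common_level by blast
  have fin: "finite (\<Union>l\<in>{1..N}. whirl_En l)" for N using finite_whirl_En by blast
  obtain p where p: "p \<in> P" "path_edges p \<inter> (\<Union>l\<in>{1..n}. whirl_En l) = {}"
    using infinite_edge_disjoint_avoid[OF \<open>infinite P\<close> ed fin] by blast
  have puv: "is_uv_path whirl_V whirl_E u v p" using p paths by blast
  then have pp: "p \<noteq> []" "p ! 0 = u" "p ! (length p - 1) = v" "distinct p" "path_edges p \<subseteq> whirl_E"
    by (auto simp: is_uv_path_def hd_conv_nth last_conv_nth)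
  have "\<forall>e\<in>path_edges p. \<exists>m. e \<in> whirl_En (Suc m)" using pp(5) whirl_E_cases by blast
  \<comment> \<open>The choice is shifted by one: \<open>e\<close> has level
    \<open>Suc (lev e)\<close>.\<close>
  then obtain lev where lev: "\<And>e. e \<in> path_edges p \<Longrightarrow> e \<in> whirl_En (Suc (lev e))" by metis
  have "path_edges p \<noteq> {}" using puv V by (intro path_edges_nonempty) (auto simp: is_uv_path_def)
  then have "Max (lev ` path_edges p) \<in> lev ` path_edges p"
    using finite_path_edges[of p] by (intro Max_in) auto
  then obtain e where e: "e \<in> path_edges p" "Max (lev ` path_edges p) = lev e" by blast
  have lev_le: "lev e' \<le> lev e" if "e' \<in> path_edges p" for e'
    using finite_path_edges[of p] that unfolding e(2)[symmetric] by simp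
  define m where "m = lev e"
  have em: "e \<in> whirl_En (Suc m)" using lev e by (simp add: m_def)
  then have nm: "n \<le> m" using p(2) e(1) by (force simp: not_le)
  obtain x where x: "x \<in> e" "x \<notin> whirl_Vn m"
    "(\<forall>l\<le>m. \<forall>y. {x, y} \<in> whirl_En (Suc l) \<longrightarrow> y < x) \<or>
     (\<forall>l\<le>m. \<forall>y. {x, y} \<in> whirl_En (Suc l) \<longrightarrow> x < y)"
    using fresh_vertex_one_sided[OF em] by metis
  obtain i where i: "i < length p" "p ! i = x"
    using x(1) path_edges_subset[OF e(1)] by (meson in_set_conv_nth subsetD)
  \<comment> \<open>Both ends lie in \<open>whirl_Vn m\<close>, so \<open>x\<close> is an inner
    vertex of \<open>p\<close> and has a predecessor \<open>y\<close> and a successor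
    \<open>z\<close>.\<close>
  have "x \<noteq> u" "x \<noteq> v" using x(2) n whirl_Vn_mono[OF nm] by auto
  then have "i \<noteq> 0" "i \<noteq> length p - 1" using i(2) pp(2,3) by metis+
  then obtain i' where i': "i = Suc i'" "Suc (Suc i') < length p" using i(1) by (cases i) auto
  define y z where "y = p ! i'" and "z = p ! Suc (Suc i')"
  have xyz: "{y, x} \<in> path_edges p" "{x, z} \<in> path_edges p"
    using path_edges_nth[of i' p] path_edges_nth[of i p] i i' by (auto simp: y_def z_def)
  \<comment> \<open>By maximality of \<open>lev e\<close> both edges of \<open>p\<close> at
    \<open>x\<close> fall under the one-sidedness of \<open>x\<close>.\<close>
  have "(y < x \<and> z < x) \<or> (x < y \<and> x < z)"
    using x(3) lev[OF xyz(1)] lev[OF xyz(2)] lev_le[OF xyz(1)] lev_le[OF xyz(2)]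
    unfolding m_def by (metis insert_commute)
  moreover
  have yxz: "precedes_in p y x" "precedes_in p x z"
    using i i' precedes_in_nth[of i' i p] precedes_in_nth[of i "Suc i" p]
    by (auto simp: y_def z_def)
  \<comment> \<open>All vertices on edges of \<open>p\<close> are points of
    \<open>whirl_Vn (Suc m)\<close> between \<open>u\<close> and \<open>v\<close>, so
    \<open>q\<close> visits all of them in increasing order.\<close>
  obtain q where q: "q \<in> P" "path_edges q \<inter> (\<Union>l\<in>{1..Suc m}. whirl_En l) = {}"
    using infinite_edge_disjoint_avoid[OF \<open>infinite P\<close> ed fin] by blast
  have quv: "is_uv_path whirl_V whirl_E u v q" using q paths by blast
  have "e \<in> (\<Union>l\<in>{1..Suc m}. whirl_En l)" using em by (intro UN_I[of "Suc m"]) auto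
  then have "p \<noteq> q" using e(1) q(2) by blast
  then have comp: "order_compatible p q" using oc p q by (auto simp: pairwise_def)
  have inV: "w \<in> whirl_Vn (Suc m)" if "e' \<in> path_edges p" "w \<in> e'" for e' w
    using lev[OF that(1)] whirl_En_subset lev_le[OF that(1)] whirl_Vn_mono[of "Suc (lev e')" "Suc m"] that(2)
    unfolding m_def by blast
  have pI: "set p \<subseteq> {u..v}" using fine_path_in_interval[OF puv p(2) n V(3)] .
  have inc: "precedes_in q w w'"
    if "w \<in> set p" "w' \<in> set p" "w \<in> whirl_Vn (Suc m)" "w' \<in> whirl_Vn (Suc m)" "w < w'" for w w'
  proof -
    have "u \<le> w" "w' \<le> v" using that(1,2) pI by (meson atLeastAtMost_iff subsetD)+
    then show ?thesis using fine_path_increasing[OF quv q(2)] that(3-5) by blast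
  qed
  have dq: "distinct q" using quv by (simp add: is_uv_path_def)
  \<comment> \<open>Order-compatibility carries the increasing order from \<open>q\<close> back to
    \<open>p\<close>; applied to \<open>y, x\<close> and \<open>x, z\<close> it contradicts the
    one-sidedness.\<close>
  have less: "w < w'" if "precedes_in p w w'" "w \<in> whirl_Vn (Suc m)" "w' \<in> whirl_Vn (Suc m)" for w w'
  proof (rule ccontr)
    assume "\<not> w < w'"
    have mem: "w \<in> set p" "w' \<in> set p" and "w \<noteq> w'"
      using that(1) pp(4) by (auto simp: precedes_in_def nth_eq_iff_index_eq)
    then have w: "w' < w" using \<open>\<not> w < w'\<close> by auto
    then have q': "precedes_in q w' w" using inc that mem by blast
    then have "w \<in> set q" "w' \<in> set q" by (auto simp: precedes_in_def)
    then have "precedes_in q w w'" using comp mem that(1) by (auto simp: order_compatible_def)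
    then show False using precedes_in_distinct[OF dq q'] by simp
  qed
  have "y < x" "x < z" using less[OF yxz(1)] less[OF yxz(2)] inV[OF xyz(1)] inV[OF xyz(2)] by auto
  ultimately show False by auto
qed

lemma no_infinite_family:
  assumes "u \<in> whirl_V" "v \<in> whirl_V" "u \<noteq> v" "infinite P"
    and "\<forall>p\<in>P. is_uv_path whirl_V whirl_E u v p"
    and "pairwise edge_disjoint P" "pairwise order_compatible P"
  shows False
proof (cases "u < v")
  case True
  then show ?thesis using assms no_infinite_family_less by blast
next
  case False
  have "infinite (rev ` P)" using assms(4) by (simp add: finite_image_iff inj_on_def)
  moreover have "\<forall>p\<in>rev ` P. is_uv_path whirl_V whirl_E v u p"
    using assms(5) by (auto intro: is_uv_path_rev)
  moreover have "pairwise edge_disjoint (rev ` P)" "pairwise order_compatible (rev ` P)"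
    using assms by (auto intro!: pairwise_rev_image simp: edge_disjoint_rev order_compatible_rev)
  ultimately show ?thesis using no_infinite_family_less[of v u "rev ` P"] assms False by auto
qed

theorem theorem1:
  "simple_graph whirl_V whirl_E \<and> countable whirl_V \<and> planar_graph whirl_V whirl_E \<and>
   (\<forall>u\<in>whirl_V. \<forall>v\<in>whirl_V. u \<noteq> v \<longrightarrow>
     (\<forall>k::nat. \<exists>P. finite P \<and> card P = k \<and>
        (\<forall>p\<in>P. is_uv_path whirl_V whirl_E u v p) \<and>
        pairwise edge_disjoint P \<and> pairwise order_compatible P)) \<and>
   (\<forall>u\<in>whirl_V. \<forall>v\<in>whirl_V. u \<noteq> v \<longrightarrow>
     \<not> (\<exists>P. infinite P \<and>
        (\<forall>p\<in>P. is_uv_path whirl_V whirl_E u v p) \<and>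
        pairwise edge_disjoint P \<and> pairwise order_compatible P))"
proof (intro conjI ballI impI allI)
  show "countable whirl_V" by (rule countableI_type)
qed (use whirl_simple_graph whirl_planar finitely_many_paths no_infinite_family in blast)+

end
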